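(* Let $\mathsf{C}$ be a category. Then: (1) The pair $\Delta_{\mathsf{C}}=\left(\Delta_{\mathrm{Ob}(\mathsf{C})},(\Delta_{\mathrm{Hom}_{\mathsf{C}}(a,b)})_{(a,b)\in\mathrm{Ob}(\mathsf{C})^{2}}\right)$ (where the component indexed by $(a,b)$ is the one at $\left(\begin{smallmatrix}a&b\\ a&b\end{smallmatrix}\right)$, and $\Delta_X$ denotes the diagonal of $X$) is a Riguet congruence on $\mathsf{C}$, and it is the smallest one. (2) Let $\Theta_{\mathrm{Ob}(\mathsf{C})}$ be the set of all $(a,b)\in\mathrm{Ob}(\mathsf{C})\times\mathrm{Ob}(\mathsf{C})$ such that $\mathrm{Hom}_{\mathsf{C}}(a,b)\neq\varnothing$ and $\mathrm{Hom}_{\mathsf{C}}(b,a)\neq\varnothing$. Then the pair $\Theta_{\mathsf{C}}$ whose object part is $\Theta_{\mathrm{Ob}(\mathsf{C})}$ and whose component at $\left(\begin{smallmatrix}a&b\\ a'&b'\end{smallmatrix}\right)$, for $(a,a'),(b,b')\in\Theta_{\mathrm{Ob}(\mathsf{C})}$, is $\mathrm{Hom}_{\mathsf{C}}(a,b)\times\mathrm{Hom}_{\mathsf{C}}(a',b')$, is a Riguet congruence on $\mathsf{C}$, and it is the greatest one. (3) If $\mathcal{F}$ is a nonempty directed subset of $\mathrm{RCgr}(\mathsf{C})$, then $\bigcup\mathcal{F}\in\mathrm{RCgr}(\mathsf{C})$. Therefore $\mathrm{RCgr}(\mathsf{C})$, ordered by inclusion, is a bounded directed-complete ordered set, i.e.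 a dcpo with both a minimum and a maximum element.
   Context: A Riguet congruence on a category $\mathsf{C}$ is a pair $\Phi=(\Phi^{\mathrm{ob}},\Phi^{\mathrm{fl}})$ where $\Phi^{\mathrm{ob}}$ is an equivalence relation on $\mathrm{Ob}(\mathsf{C})$ and $\Phi^{\mathrm{fl}}$ assigns to all $(a,a'),(b,b')\in\Phi^{\mathrm{ob}}$ a subset $\Phi^{\mathrm{fl}}_{\left(\begin{smallmatrix}a&b\\ a'&b'\end{smallmatrix}\right)}\subseteq\mathrm{Hom}_{\mathsf{C}}(a,b)\times\mathrm{Hom}_{\mathsf{C}}(a',b')$ such that: (a) if $(a,b)\in\Phi^{\mathrm{ob}}$, then $(\mathrm{id}_a,\mathrm{id}_b)\in\Phi^{\mathrm{fl}}_{\left(\begin{smallmatrix}a&a\\ b&b\end{smallmatrix}\right)}$; (b) if $f\in\mathrm{Hom}_{\mathsf{C}}(a,b)$, then $(f,f)\in\Phi^{\mathrm{fl}}_{\left(\begin{smallmatrix}a&b\\ a&b\end{smallmatrix}\right)}$; (c) if $(f,f')\in\Phi^{\mathrm{fl}}_{\left(\begin{smallmatrix}a&b\\ a'&b'\end{smallmatrix}\right)}$, then $(f',f)\in\Phi^{\mathrm{fl}}_{\left(\begin{smallmatrix}a'&b'\\ a&b\end{smallmatrix}\right)}$; (d) if $(f,f')\in\Phi^{\mathrm{fl}}_{\left(\begin{smallmatrix}a&b\\ a'&b'\end{smallmatrix}\right)}$ and $(f',f'')\in\Phi^{\mathrm{fl}}_{\left(\begin{smallmatrix}a'&b'\\ a''&b''\end{smallmatrix}\right)}$,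 then $(f,f'')\in\Phi^{\mathrm{fl}}_{\left(\begin{smallmatrix}a&b\\ a''&b''\end{smallmatrix}\right)}$; (e) if $(f,f')\in\Phi^{\mathrm{fl}}_{\left(\begin{smallmatrix}a&b\\ a'&b'\end{smallmatrix}\right)}$ and $(g,g')\in\Phi^{\mathrm{fl}}_{\left(\begin{smallmatrix}b&c\\ b'&c'\end{smallmatrix}\right)}$, then $(g\circ f,g'\circ f')\in\Phi^{\mathrm{fl}}_{\left(\begin{smallmatrix}a&c\\ a'&c'\end{smallmatrix}\right)}$; (f) for all $(a,a'),(b,b')\in\Phi^{\mathrm{ob}}$ and $f\in\mathrm{Hom}_{\mathsf{C}}(a,b)$ there is $f'\in\mathrm{Hom}_{\mathsf{C}}(a',b')$ with $(f,f')\in\Phi^{\mathrm{fl}}_{\left(\begin{smallmatrix}a&b\\ a'&b'\end{smallmatrix}\right)}$. $\mathrm{RCgr}(\mathsf{C})$ is the set of all Riguet congruences on $\mathsf{C}$. Inclusion and union are defined coordinatewise: $\Phi\subseteq\Upsilon$ iff $\Phi^{\mathrm{ob}}\subseteq\Upsilon^{\mathrm{ob}}$ and each component of $\Phi^{\mathrm{fl}}$ is included in the component of $\Upsilon^{\mathrm{fl}}$ with the same index; the component of a union at an index is the union of the components at that index of those members for which it is defined. *)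

theory Defs
  imports "HOL-Algebra.Order"
begin

text \<open>
  Hom-sets are indexed by pairs of objects and are not required to be disjoint. Therefore
  composition takes its objects as arguments: \<open>Comp C a b c g f\<close> is the composite of
  \<open>f \<in> Hom C a b\<close> and \<open>g \<in> Hom C b c\<close>. Values off the objects and hom-sets are irrelevant.
\<close>

record ('o, 'm) cat_data =
  Ob :: "'o set"
  Hom :: "'o \<Rightarrow> 'o \<Rightarrow> 'm set"
  Idn :: "'o \<Rightarrow> 'm"
  Comp :: "'o \<Rightarrow> 'o \<Rightarrow> 'o \<Rightarrow> 'm \<Rightarrow> 'm \<Rightarrow> 'm"

locale category =
  fixes C :: "('o, 'm) cat_data"
  assumes Idn_closed: "a \<in> Ob C \<Longrightarrow> Idn C a \<in> Hom C a a"
    and Comp_closed: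
      "\<lbrakk>a \<in> Ob C; b \<in> Ob C; c \<in> Ob C; f \<in> Hom C a b; g \<in> Hom C b c\<rbrakk>
        \<Longrightarrow> Comp C a b c g f \<in> Hom C a c"
    and Comp_Idn_right:
      "\<lbrakk>a \<in> Ob C; b \<in> Ob C; f \<in> Hom C a b\<rbrakk> \<Longrightarrow> Comp C a a b f (Idn C a) = f"
    and Comp_Idn_left:
      "\<lbrakk>a \<in> Ob C; b \<in> Ob C; f \<in> Hom C a b\<rbrakk> \<Longrightarrow> Comp C a b b (Idn C b) f = f"
    and Comp_assoc:
      "\<lbrakk>a \<in> Ob C; b \<in> Ob C; c \<in> Ob C; d \<in> Ob C;
        f \<in> Hom C a b; g \<in> Hom C b c; h \<in> Hom C c d\<rbrakk>
        \<Longrightarrow> Comp C a c d h (Comp C a b c g f) = Comp C a b d (Comp C b c d h g) f"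

text \<open>
  A pair (object part, family of arrow parts). The component at the matrix with rows
  \<open>a b\<close> and \<open>a' b'\<close> is \<open>fl \<Phi> a b a' b'\<close>; it is defined for \<open>(a, a')\<close> and \<open>(b, b')\<close> in
  the object part. By convention it is empty at all other indices, so that equality of
  pairs is equality of the object parts and of the components that are defined.
\<close>

type_synonym ('o, 'm) cong_pair =
  "('o \<times> 'o) set \<times> ('o \<Rightarrow> 'o \<Rightarrow> 'o \<Rightarrow> 'o \<Rightarrow> ('m \<times> 'm) set)"

abbreviation ob :: "('o, 'm) cong_pair \<Rightarrow> ('o \<times> 'o) set"
  where "ob \<equiv> fst"

abbreviation fl :: "('o, 'm) cong_pair \<Rightarrow> 'o \<Rightarrow> 'o \<Rightarrow> 'o \<Rightarrow> 'o \<Rightarrow> ('m \<times> 'm) set"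
  where "fl \<equiv> snd"

text \<open>
  The indices in \<open>fl_sym\<close>, \<open>fl_trans\<close> and \<open>fl_Comp\<close> need no side conditions: a component with an
  element is defined at its index.
\<close>

locale riguet_congruence = category C
  for C :: "('o, 'm) cat_data" +
  fixes \<Phi> :: "('o, 'm) cong_pair"
  assumes ob_equiv: "equiv (Ob C) (ob \<Phi>)"
    and fl_subset:
      "\<lbrakk>(a, a') \<in> ob \<Phi>; (b, b') \<in> ob \<Phi>\<rbrakk> \<Longrightarrow> fl \<Phi> a b a' b' \<subseteq> Hom C a b \<times> Hom C a' b'"
    and fl_undefined:
      "\<not> ((a, a') \<in> ob \<Phi> \<and> (b, b') \<in> ob \<Phi>) \<Longrightarrow> fl \<Phi> a b a' b' = {}"
    and fl_Idn: "(a, b) \<in> ob \<Phi> \<Longrightarrow> (Idn C a, Idn C b) \<in> fl \<Phi> a a b b"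
    and fl_refl: "\<lbrakk>a \<in> Ob C; b \<in> Ob C; f \<in> Hom C a b\<rbrakk> \<Longrightarrow> (f, f) \<in> fl \<Phi> a b a b"
    and fl_sym: "(f, f') \<in> fl \<Phi> a b a' b' \<Longrightarrow> (f', f) \<in> fl \<Phi> a' b' a b"
    and fl_trans: "\<lbrakk>(f, f') \<in> fl \<Phi> a b a' b'; (f', f'') \<in> fl \<Phi> a' b' a'' b''\<rbrakk>
        \<Longrightarrow> (f, f'') \<in> fl \<Phi> a b a'' b''"
    and fl_Comp: "\<lbrakk>(f, f') \<in> fl \<Phi> a b a' b'; (g, g') \<in> fl \<Phi> b c b' c'\<rbrakk>
        \<Longrightarrow> (Comp C a b c g f, Comp C a' b' c' g' f') \<in> fl \<Phi> a c a' c'"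
    and fl_lift: "\<lbrakk>(a, a') \<in> ob \<Phi>; (b, b') \<in> ob \<Phi>; f \<in> Hom C a b\<rbrakk>
        \<Longrightarrow> \<exists>f' \<in> Hom C a' b'. (f, f') \<in> fl \<Phi> a b a' b'"

definition RCgr :: "('o, 'm) cat_data \<Rightarrow> ('o, 'm) cong_pair set"
  where "RCgr C = {\<Phi>. riguet_congruence C \<Phi>}"

definition rc_subset :: "('o, 'm) cong_pair \<Rightarrow> ('o, 'm) cong_pair \<Rightarrow> bool"
  where "rc_subset \<Phi> \<Upsilon> \<longleftrightarrow> ob \<Phi> \<subseteq> ob \<Upsilon> \<and>
    (\<forall>a a' b b'. (a, a') \<in> ob \<Phi> \<and> (b, b') \<in> ob \<Phi> \<longrightarrow>
      fl \<Phi> a b a' b' \<subseteq> fl \<Upsilon> a b a' b')"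

definition rc_Union :: "('o, 'm) cong_pair set \<Rightarrow> ('o, 'm) cong_pair"
  where "rc_Union F =
    (\<Union>\<Phi>\<in>F. ob \<Phi>,
     \<lambda>a b a' b'. \<Union>\<Phi>\<in>{\<Phi> \<in> F. (a, a') \<in> ob \<Phi> \<and> (b, b') \<in> ob \<Phi>}. fl \<Phi> a b a' b')"

definition RCgr_order :: "('o, 'm) cat_data \<Rightarrow> ('o, 'm) cong_pair gorder"
  where "RCgr_order C = \<lparr>carrier = RCgr C, eq = (=), le = rc_subset\<rparr>"

definition Delta_cong :: "('o, 'm) cat_data \<Rightarrow> ('o, 'm) cong_pair"
  where "Delta_cong C =
    (Id_on (Ob C),
     \<lambda>a b a' b'. if (a, a') \<in> Id_on (Ob C) \<and> (b, b') \<in> Id_on (Ob C)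
       then Id_on (Hom C a b) else {})"

definition Theta_Ob :: "('o, 'm) cat_data \<Rightarrow> ('o \<times> 'o) set"
  where "Theta_Ob C = {(a, b) \<in> Ob C \<times> Ob C. Hom C a b \<noteq> {} \<and> Hom C b a \<noteq> {}}"

definition Theta_cong :: "('o, 'm) cat_data \<Rightarrow> ('o, 'm) cong_pair"
  where "Theta_cong C =
    (Theta_Ob C,
     \<lambda>a b a' b'. if (a, a') \<in> Theta_Ob C \<and> (b, b') \<in> Theta_Ob C
       then Hom C a b \<times> Hom C a' b' else {})"

definition directed_subset :: "('a, 'x) gorder_scheme \<Rightarrow> 'a set \<Rightarrow> bool"
  where "directed_subset L D \<longleftrightarrow> D \<subseteq> carrier L \<and>
    (\<forall>x\<in>D. \<forall>y\<in>D. \<exists>z\<in>D. x \<sqsubseteq>\<^bsub>L\<^esub> z \<and> y \<sqsubseteq>\<^bsub>L\<^esub> z)"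

locale dcpo = partial_order L for L (structure) +
  assumes directed_lub:
    "\<lbrakk>directed_subset L D; D \<noteq> {}\<rbrakk> \<Longrightarrow> \<exists>s. least L s (Upper L D)"

locale bounded_dcpo = dcpo L + weak_partial_order_bottom L + weak_partial_order_top L
  for L (structure)

end

theory Submission
  imports Defs
begin

text \<open>
  Each axiom of a Riguet congruence assumes at most two memberships in the congruence, and its
  conclusion persists in larger congruences. In a nonempty directed union, two memberships already
  hold in a single member of the family, where the axiom applies (lemma \<open>rc_Union_riguet\<close>). So
  the union is again a Riguet congruence, and it is then the supremum of the family.

  The extremal congruences come from reflexivity and lifting. Reflexivity on objects and on arrows
  forces the diagonal pair into every congruence. The lifting axiom bounds the object
  part from above: if \<open>a\<close> is congruent to \<open>b\<close>, then the identity of \<open>a\<close> lifts along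
  \<open>(a, a)\<close>, \<open>(a, b)\<close> to an arrow from \<open>a\<close> to \<open>b\<close>, and symmetrically there is an arrow
  back (lemma \<open>ob_imp_Hom_nonempty\<close>). Conversely, mutual existence of
  arrows suffices for lifting when any two arrows count as congruent, because an arrow from \<open>a\<close> to \<open>b\<close> can be composed with arrows from \<open>a'\<close> to
  \<open>a\<close> and from \<open>b\<close> to \<open>b'\<close>.
\<close>

section \<open>The inclusion order\<close>

context riguet_congruence
begin

lemma ob_refl: "a \<in> Ob C \<Longrightarrow> (a, a) \<in> ob \<Phi>"
  using ob_equiv by (auto simp: equiv_def refl_on_def)

lemma ob_sym: "(a, b) \<in> ob \<Phi> \<Longrightarrow> (b, a) \<in> ob \<Phi>"
  using ob_equiv by (auto simp: equiv_def sym_def)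

lemma ob_trans: "\<lbrakk>(a, b) \<in> ob \<Phi>; (b, c) \<in> ob \<Phi>\<rbrakk> \<Longrightarrow> (a, c) \<in> ob \<Phi>"
  using ob_equiv by (auto simp: equiv_def dest: transD)

lemma ob_closed: "(a, b) \<in> ob \<Phi> \<Longrightarrow> a \<in> Ob C \<and> b \<in> Ob C"
  using ob_equiv equiv_type by fastforce

lemma fl_defined: "p \<in> fl \<Phi> a b a' b' \<Longrightarrow> (a, a') \<in> ob \<Phi> \<and> (b, b') \<in> ob \<Phi>"
  using fl_undefined by blast

end

text \<open>
  An undefined component of a congruence is empty, so the restriction to defined indices is vacuous
  on the left-hand side of an inclusion.
\<close>

lemma rc_subset_iff:
  assumes "riguet_congruence C \<Phi>"
  shows "rc_subset \<Phi> \<Upsilon> \<longleftrightarrow>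
    ob \<Phi> \<subseteq> ob \<Upsilon> \<and> (\<forall>a b a' b'. fl \<Phi> a b a' b' \<subseteq> fl \<Upsilon> a b a' b')"
  unfolding rc_subset_def using riguet_congruence.fl_defined[OF assms] by blast

lemma rc_subset_refl: "rc_subset \<Phi> \<Phi>"
  by (simp add: rc_subset_def)

lemma rc_subset_trans: "\<lbrakk>rc_subset \<Phi> \<Upsilon>; rc_subset \<Upsilon> \<Psi>\<rbrakk> \<Longrightarrow> rc_subset \<Phi> \<Psi>"
  unfolding rc_subset_def by blast

lemma rc_subset_antisym:
  assumes "riguet_congruence C \<Phi>" "riguet_congruence C \<Upsilon>"
    and "rc_subset \<Phi> \<Upsilon>" "rc_subset \<Upsilon> \<Phi>"
  shows "\<Phi> = \<Upsilon>"
proof (rule prod_eqI)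
  show "ob \<Phi> = ob \<Upsilon>"
    using assms by (auto simp: rc_subset_def)
  show "fl \<Phi> = fl \<Upsilon>"
    using assms rc_subset_iff[OF assms(1)] rc_subset_iff[OF assms(2)]
    by (intro ext) blast
qed

lemma partial_order_RCgr: "partial_order (RCgr_order C)"
proof
  fix x y z w
  assume "x \<in> carrier (RCgr_order C)" "y \<in> carrier (RCgr_order C)"
    and "x \<sqsubseteq>\<^bsub>RCgr_order C\<^esub> y" "y \<sqsubseteq>\<^bsub>RCgr_order C\<^esub> x"
  then show "x .=\<^bsub>RCgr_order C\<^esub> y"
    using rc_subset_antisym[of C x y] by (simp add: RCgr_order_def RCgr_def)
next
  fix x y z
  assume "x \<sqsubseteq>\<^bsub>RCgr_order C\<^esub> y" "y \<sqsubseteq>\<^bsub>RCgr_order C\<^esub> z"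
  then show "x \<sqsubseteq>\<^bsub>RCgr_order C\<^esub> z"
    using rc_subset_trans[of x y z] by (simp add: RCgr_order_def)
qed (auto simp: RCgr_order_def rc_subset_refl)

section \<open>The smallest and the greatest congruence\<close>

context category
begin

lemma Delta_cong_riguet: "riguet_congruence C (Delta_cong C)"
  by unfold_locales
    (auto simp: Delta_cong_def equiv_def refl_on_def sym_def trans_def
      Idn_closed Comp_closed split: if_splits)

lemma Delta_cong_least:
  assumes "riguet_congruence C \<Phi>"
  shows "rc_subset (Delta_cong C) \<Phi>"
  using riguet_congruence.ob_refl[OF assms] riguet_congruence.fl_refl[OF assms]
  by (auto simp: rc_subset_def Delta_cong_def)

lemma Hom_nonempty_trans:
  assumes "a \<in> Ob C" "b \<in> Ob C" "c \<in> Ob C" "Hom C a b \<noteq> {}" "Hom C b c \<noteq> {}"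
  shows "Hom C a c \<noteq> {}"
  using assms Comp_closed by blast

lemma Theta_Ob_equiv: "equiv (Ob C) (Theta_Ob C)"
proof (rule equivI)
  show "Theta_Ob C \<subseteq> Ob C \<times> Ob C" "sym (Theta_Ob C)"
    by (auto simp: Theta_Ob_def sym_def)
  show "refl_on (Ob C) (Theta_Ob C)"
    using Idn_closed by (auto simp: Theta_Ob_def refl_on_def)
  show "trans (Theta_Ob C)"
    by (rule transI) (auto simp: Theta_Ob_def dest: Hom_nonempty_trans)
qed

text \<open>
  The axiom that needs an argument is lifting: an arrow from \<open>a\<close> to \<open>b\<close> has to produce some arrow between the
  equivalent objects \<open>a'\<close> and \<open>b'\<close>, which the path \<open>a'\<close>, \<open>a\<close>, \<open>b\<close>, \<open>b'\<close> gives.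
\<close>

lemma Theta_cong_riguet: "riguet_congruence C (Theta_cong C)"
proof -
  have Ob: "a \<in> Ob C \<and> b \<in> Ob C" if "(a, b) \<in> Theta_Ob C" for a b
    using that by (auto simp: Theta_Ob_def)
  have refl: "(a, a) \<in> Theta_Ob C" if "a \<in> Ob C" for a
    using that Theta_Ob_equiv by (auto simp: equiv_def refl_on_def)
  have sym: "(b, a) \<in> Theta_Ob C" if "(a, b) \<in> Theta_Ob C" for a b
    using that by (auto simp: Theta_Ob_def)
  have trans: "(a, c) \<in> Theta_Ob C" if "(a, b) \<in> Theta_Ob C" "(b, c) \<in> Theta_Ob C" for a b c
    using that Theta_Ob_equiv by (auto simp: equiv_def dest: transD)
  have lift: "Hom C a' b' \<noteq> {}"
    if "(a, a') \<in> Theta_Ob C" "(b, b') \<in> Theta_Ob C" "f \<in> Hom C a b" for a a' b b' f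
    using that Hom_nonempty_trans[of a' a b] Hom_nonempty_trans[of a' b b']
    by (auto simp: Theta_Ob_def)
  show ?thesis
  proof
    show "equiv (Ob C) (ob (Theta_cong C))"
      using Theta_Ob_equiv by (simp add: Theta_cong_def)
  next
    fix a a' b b' f
    assume "(a, a') \<in> ob (Theta_cong C)" "(b, b') \<in> ob (Theta_cong C)" "f \<in> Hom C a b"
    then show "\<exists>f' \<in> Hom C a' b'. (f, f') \<in> fl (Theta_cong C) a b a' b'"
      using lift[of a a' b b' f] by (auto simp: Theta_cong_def)
  next
    fix f f' f'' a b a' b' a'' b''
    assume "(f, f') \<in> fl (Theta_cong C) a b a' b'"
      "(f', f'') \<in> fl (Theta_cong C) a' b' a'' b''"
    then show "(f, f'') \<in> fl (Theta_cong C) a b a'' b''"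
      using trans by (auto simp: Theta_cong_def split: if_splits)
  next
    fix f f' g g' a b c a' b' c'
    assume "(f, f') \<in> fl (Theta_cong C) a b a' b'" "(g, g') \<in> fl (Theta_cong C) b c b' c'"
    then show "(Comp C a b c g f, Comp C a' b' c' g' f') \<in> fl (Theta_cong C) a c a' c'"
      using Ob by (auto simp: Theta_cong_def intro!: Comp_closed split: if_splits)
  qed (use Ob refl sym Idn_closed in \<open>auto simp: Theta_cong_def split: if_splits\<close>)
qed

text \<open>
  Lifting the identity of \<open>a\<close> to an arrow from \<open>a\<close> to \<open>b\<close> is what bounds the object part of a
  congruence.
\<close>

lemma ob_imp_Hom_nonempty:
  assumes "riguet_congruence C \<Phi>" and "(a, b) \<in> ob \<Phi>"
  shows "Hom C a b \<noteq> {}"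
proof -
  interpret riguet_congruence C \<Phi> by (fact assms(1))
  have "a \<in> Ob C" using ob_closed assms(2) by blast
  then show ?thesis
    using fl_lift[of a a a b "Idn C a"] ob_refl Idn_closed assms(2) by blast
qed

lemma Theta_cong_greatest:
  assumes "riguet_congruence C \<Phi>"
  shows "rc_subset \<Phi> (Theta_cong C)"
proof -
  interpret riguet_congruence C \<Phi> by (fact assms)
  have "ob \<Phi> \<subseteq> Theta_Ob C"
    using ob_imp_Hom_nonempty[OF assms] ob_sym ob_closed by (auto simp: Theta_Ob_def)
  then show ?thesis
    using fl_subset by (auto simp: rc_subset_def Theta_cong_def subset_iff)
qed

end

section \<open>Directed unions\<close>

lemma mem_fl_rc_Union:
  assumes "\<And>\<Phi>. \<Phi> \<in> F \<Longrightarrow> riguet_congruence C \<Phi>"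
  shows "p \<in> fl (rc_Union F) a b a' b' \<longleftrightarrow> (\<exists>\<Phi>\<in>F. p \<in> fl \<Phi> a b a' b')"
proof -
  have "(a, a') \<in> ob \<Phi> \<and> (b, b') \<in> ob \<Phi>" if "\<Phi> \<in> F" "p \<in> fl \<Phi> a b a' b'" for \<Phi>
    using riguet_congruence.fl_defined[OF assms] that by meson
  then show ?thesis
    unfolding rc_Union_def snd_conv UN_iff mem_Collect_eq Bex_def by metis
qed

lemma mem_ob_rc_Union: "p \<in> ob (rc_Union F) \<longleftrightarrow> (\<exists>\<Phi>\<in>F. p \<in> ob \<Phi>)"
  by (simp add: rc_Union_def)

text \<open>
  Nonemptiness supplies reflexivity on objects and on arrows. Directedness serves the axioms with
  two premises, namely transitivity, composition and lifting: premises that come from two members of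
  the family hold together in a common upper bound.
\<close>

lemma (in category) rc_Union_riguet:
  assumes "F \<noteq> {}" and "directed_subset (RCgr_order C) F"
  shows "riguet_congruence C (rc_Union F)"
proof -
  have cong: "riguet_congruence C \<Phi>" if "\<Phi> \<in> F" for \<Phi>
    using assms(2) that by (auto simp: directed_subset_def RCgr_order_def RCgr_def)
  have mem_fl: "p \<in> fl (rc_Union F) a b a' b' \<longleftrightarrow> (\<exists>\<Phi>\<in>F. p \<in> fl \<Phi> a b a' b')" for p a b a' b'
    by (rule mem_fl_rc_Union) (rule cong)
  have bound: "\<exists>\<Psi>\<in>F.
      (ob \<Phi> \<subseteq> ob \<Psi> \<and> (\<forall>a b a' b'. fl \<Phi> a b a' b' \<subseteq> fl \<Psi> a b a' b')) \<and>
      (ob \<Upsilon> \<subseteq> ob \<Psi> \<and> (\<forall>a b a' b'. fl \<Upsilon> a b a' b' \<subseteq> fl \<Psi> a b a' b'))"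
    if "\<Phi> \<in> F" "\<Upsilon> \<in> F" for \<Phi> \<Upsilon>
  proof -
    have "\<exists>\<Psi>\<in>F. rc_subset \<Phi> \<Psi> \<and> rc_subset \<Upsilon> \<Psi>"
      using assms(2) that by (simp add: directed_subset_def RCgr_order_def)
    then show ?thesis
      unfolding rc_subset_iff[OF cong[OF that(1)]] rc_subset_iff[OF cong[OF that(2)]] .
  qed
  have ob_ob: "\<exists>\<Psi>\<in>F. p \<in> ob \<Psi> \<and> q \<in> ob \<Psi>"
    if mem: "p \<in> ob (rc_Union F)" "q \<in> ob (rc_Union F)" for p q
  proof -
    obtain \<Phi> \<Upsilon> where m: "\<Phi> \<in> F" "\<Upsilon> \<in> F" and pq: "p \<in> ob \<Phi>" "q \<in> ob \<Upsilon>"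
      using mem unfolding mem_ob_rc_Union by blast
    show ?thesis using bound[OF m] pq by blast
  qed
  have fl_fl: "\<exists>\<Psi>\<in>F. p \<in> fl \<Psi> a b a' b' \<and> q \<in> fl \<Psi> c d c' d'"
    if mem: "p \<in> fl (rc_Union F) a b a' b'" "q \<in> fl (rc_Union F) c d c' d'"
    for p q a b a' b' c d c' d'
  proof -
    obtain \<Phi> \<Upsilon> where m: "\<Phi> \<in> F" "\<Upsilon> \<in> F"
      and pq: "p \<in> fl \<Phi> a b a' b'" "q \<in> fl \<Upsilon> c d c' d'"
      using mem unfolding mem_fl by blast
    show ?thesis using bound[OF m] pq by blast
  qed
  have ob_I: "p \<in> ob (rc_Union F)" if "\<Phi> \<in> F" "p \<in> ob \<Phi>" for p \<Phi>
    using that unfolding mem_ob_rc_Union by blast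
  have fl_I: "p \<in> fl (rc_Union F) a b a' b'" if "\<Phi> \<in> F" "p \<in> fl \<Phi> a b a' b'" for p a b a' b' \<Phi>
    using that unfolding mem_fl by blast
  obtain \<Phi>0 where \<Phi>0: "\<Phi>0 \<in> F" using assms(1) by blast
  show ?thesis
  proof
    show "equiv (Ob C) (ob (rc_Union F))"
    proof (rule equivI)
      show "ob (rc_Union F) \<subseteq> Ob C \<times> Ob C"
        using riguet_congruence.ob_closed[OF cong] by (auto simp: mem_ob_rc_Union)
      show "refl_on (Ob C) (ob (rc_Union F))"
        using riguet_congruence.ob_refl[OF cong[OF \<Phi>0]] ob_I[OF \<Phi>0]
        by (auto simp: refl_on_def)
      show "sym (ob (rc_Union F))"
        using riguet_congruence.ob_sym[OF cong] unfolding sym_def mem_ob_rc_Union by blast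
      show "trans (ob (rc_Union F))"
      proof (rule transI)
        fix a b c
        assume "(a, b) \<in> ob (rc_Union F)" "(b, c) \<in> ob (rc_Union F)"
        then obtain \<Psi> where \<Psi>: "\<Psi> \<in> F" "(a, b) \<in> ob \<Psi>" "(b, c) \<in> ob \<Psi>"
          using ob_ob by blast
        show "(a, c) \<in> ob (rc_Union F)"
          using ob_I[OF \<Psi>(1) riguet_congruence.ob_trans[OF cong[OF \<Psi>(1)] \<Psi>(2,3)]] .
      qed
    qed
  next
    fix a a' b b'
    show "fl (rc_Union F) a b a' b' \<subseteq> Hom C a b \<times> Hom C a' b'"
      using riguet_congruence.fl_subset[OF cong] unfolding rc_Union_def snd_conv by blast
    assume "\<not> ((a, a') \<in> ob (rc_Union F) \<and> (b, b') \<in> ob (rc_Union F))"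
    then show "fl (rc_Union F) a b a' b' = {}"
      by (auto simp: rc_Union_def)
  next
    fix a b
    assume "(a, b) \<in> ob (rc_Union F)"
    then obtain \<Psi> where \<Psi>: "\<Psi> \<in> F" "(a, b) \<in> ob \<Psi>"
      using ob_ob by blast
    interpret \<Psi>: riguet_congruence C \<Psi> by (rule cong[OF \<Psi>(1)])
    show "(Idn C a, Idn C b) \<in> fl (rc_Union F) a a b b"
      using \<Psi> by (blast intro: fl_I \<Psi>.fl_Idn)
  next
    fix a b f
    assume "a \<in> Ob C" "b \<in> Ob C" "f \<in> Hom C a b"
    then show "(f, f) \<in> fl (rc_Union F) a b a b"
      using fl_I[OF \<Phi>0] riguet_congruence.fl_refl[OF cong[OF \<Phi>0]] by blast
  next
    fix f f' a b a' b'
    assume "(f, f') \<in> fl (rc_Union F) a b a' b'"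
    then obtain \<Psi> where \<Psi>: "\<Psi> \<in> F" "(f, f') \<in> fl \<Psi> a b a' b'"
      using fl_fl by blast
    interpret \<Psi>: riguet_congruence C \<Psi> by (rule cong[OF \<Psi>(1)])
    show "(f', f) \<in> fl (rc_Union F) a' b' a b"
      using \<Psi> by (blast intro: fl_I \<Psi>.fl_sym)
  next
    fix f f' f'' a b a' b' a'' b''
    assume "(f, f') \<in> fl (rc_Union F) a b a' b'" "(f', f'') \<in> fl (rc_Union F) a' b' a'' b''"
    then obtain \<Psi> where \<Psi>: "\<Psi> \<in> F" "(f, f') \<in> fl \<Psi> a b a' b'"
      "(f', f'') \<in> fl \<Psi> a' b' a'' b''"
      using fl_fl by blast
    interpret \<Psi>: riguet_congruence C \<Psi> by (rule cong[OF \<Psi>(1)])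
    show "(f, f'') \<in> fl (rc_Union F) a b a'' b''"
      by (rule fl_I[OF \<Psi>(1) \<Psi>.fl_trans[OF \<Psi>(2,3)]])
  next
    fix f f' g g' a b c a' b' c'
    assume "(f, f') \<in> fl (rc_Union F) a b a' b'" "(g, g') \<in> fl (rc_Union F) b c b' c'"
    then obtain \<Psi> where \<Psi>: "\<Psi> \<in> F" "(f, f') \<in> fl \<Psi> a b a' b'"
      "(g, g') \<in> fl \<Psi> b c b' c'"
      using fl_fl by blast
    interpret \<Psi>: riguet_congruence C \<Psi> by (rule cong[OF \<Psi>(1)])
    show "(Comp C a b c g f, Comp C a' b' c' g' f') \<in> fl (rc_Union F) a c a' c'"
      by (rule fl_I[OF \<Psi>(1) \<Psi>.fl_Comp[OF \<Psi>(2,3)]])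
  next
    fix a a' b b' f
    assume "(a, a') \<in> ob (rc_Union F)" "(b, b') \<in> ob (rc_Union F)" and f: "f \<in> Hom C a b"
    then obtain \<Psi> where \<Psi>: "\<Psi> \<in> F" "(a, a') \<in> ob \<Psi>" "(b, b') \<in> ob \<Psi>"
      using ob_ob by blast
    interpret \<Psi>: riguet_congruence C \<Psi> by (rule cong[OF \<Psi>(1)])
    show "\<exists>f' \<in> Hom C a' b'. (f, f') \<in> fl (rc_Union F) a b a' b'"
      using \<Psi>.fl_lift[OF \<Psi>(2,3) f] fl_I[OF \<Psi>(1)] by blast
  qed
qed

lemma rc_Union_upper:
  assumes "\<Phi> \<in> F"
  shows "rc_subset \<Phi> (rc_Union F)"
  using assms by (auto simp: rc_subset_def rc_Union_def)

lemma rc_Union_least: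
  assumes "\<And>\<Phi>. \<Phi> \<in> F \<Longrightarrow> rc_subset \<Phi> \<Upsilon>"
  shows "rc_subset (rc_Union F) \<Upsilon>"
  using assms unfolding rc_subset_def rc_Union_def by fastforce

section \<open>The bounded dcpo of Riguet congruences\<close>

lemma (in category) bounded_dcpo_RCgr: "bounded_dcpo (RCgr_order C)"
proof -
  interpret partial_order "RCgr_order C" by (rule partial_order_RCgr)
  show ?thesis
  proof
    fix D
    assume D: "directed_subset (RCgr_order C) D" "D \<noteq> {}"
    have "D \<subseteq> RCgr C"
      using D(1) by (simp add: directed_subset_def RCgr_order_def)
    moreover have "rc_Union D \<in> RCgr C"
      using rc_Union_riguet[OF D(2,1)] by (simp add: RCgr_def)
    ultimately have "least (RCgr_order C) (rc_Union D) (Upper (RCgr_order C) D)"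
      unfolding least_def Upper_def RCgr_order_def gorder.simps partial_object.simps
      by (blast intro: rc_Union_least rc_Union_upper)
    then show "\<exists>s. least (RCgr_order C) s (Upper (RCgr_order C) D)" ..
  next
    have "least (RCgr_order C) (Delta_cong C) (carrier (RCgr_order C))"
      using Delta_cong_riguet Delta_cong_least
      by (simp add: least_def RCgr_order_def RCgr_def)
    then show "\<exists>x. least (RCgr_order C) x (carrier (RCgr_order C))" ..
  next
    have "greatest (RCgr_order C) (Theta_cong C) (carrier (RCgr_order C))"
      using Theta_cong_riguet Theta_cong_greatest
      by (simp add: greatest_def RCgr_order_def RCgr_def)
    then show "\<exists>x. greatest (RCgr_order C) x (carrier (RCgr_order C))" ..
  qed
qed

theorem proposition2p5:
  fixes C :: "('o, 'm) cat_data"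
  assumes "category C"
  shows "(riguet_congruence C (Delta_cong C) \<and>
      (\<forall>\<Phi> \<in> RCgr C. rc_subset (Delta_cong C) \<Phi>)) \<and>
    (riguet_congruence C (Theta_cong C) \<and>
      (\<forall>\<Phi> \<in> RCgr C. rc_subset \<Phi> (Theta_cong C))) \<and>
    (\<forall>F. F \<noteq> {} \<and> directed_subset (RCgr_order C) F \<longrightarrow> rc_Union F \<in> RCgr C) \<and>
    bounded_dcpo (RCgr_order C)"
proof -
  interpret category C by (fact assms)
  show ?thesis
    using Delta_cong_riguet Delta_cong_least Theta_cong_riguet Theta_cong_greatest
      rc_Union_riguet bounded_dcpo_RCgr
    by (simp add: RCgr_def)
qed

end
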